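(* Let $M,N$ be positive integers and $x_1,\dots,x_N\in\mathbb C$. Then $\tau=\mathbf{B}(x_1)\mathbf{B}(x_2)\cdots\mathbf{B}(x_N)|0\rangle\in\mathcal F$ is a KP tau function, i.e. $$\mathrm{Res}_{z}\,b(z)\otimes c(z)\,(\tau\otimes\tau)=\sum_{i\in\mathbb Z}b(i)\tau\otimes c(-i)\tau=0 .$$
   Context: $b(i),c(i)$ ($i\in\mathbb Z$) satisfy $\{b(i),c(j)\}=\delta_{i,-j}$, $\{b(i),b(j)\}=\{c(i),c(j)\}=0$, where $\{A,B\}=AB+BA$; $b(z)=\sum_i b(i)z^{-i}$, $c(z)=\sum_i c(i)z^{-i-1}$, and $\mathrm{Res}_z$ is the coefficient of $z^{-1}$. The complex Fock space $\mathcal F$ is generated by $|0\rangle$ with $b(m+1)|0\rangle=c(m)|0\rangle=0$ for $m\ge 0$. For a fixed positive integer $M$, $$\mathbf B(x)=\exp(x\,b(-M+1)c(M-2))\exp(x\,b(-M+2)c(M-3))\cdots,$$ the ordered product of $\exp(x\,b(-(i-1))c(i-2))$, $i\le M$, with $i$ decreasing from left to right; on each fixed vector of $\mathcal F$ all but finitely many factors act as the identity. For $v\in\mathcal F$ only finitely many terms $b(i)v\otimes c(-i)v$ are nonzero. *)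

theory Defs
  imports Complex_Main "HOL-Library.Poly_Mapping"
begin

section \<open>Complex vector spaces\<close>

class complex_vector = ab_group_add +
  fixes scaleC :: "complex \<Rightarrow> 'a \<Rightarrow> 'a" (infixr "*\<^sub>C" 75)
  assumes scaleC_right_distrib: "a *\<^sub>C (x + y) = a *\<^sub>C x + a *\<^sub>C y"
    and scaleC_left_distrib: "(a + a') *\<^sub>C x = a *\<^sub>C x + a' *\<^sub>C x"
    and scaleC_scaleC: "a *\<^sub>C a' *\<^sub>C x = (a * a') *\<^sub>C x"
    and scaleC_one: "1 *\<^sub>C x = x"

global_interpretation complex_vector:
  vector_space "scaleC :: complex \<Rightarrow> 'a \<Rightarrow> 'a::complex_vector"
  by unfold_locales
    (simp_all add: scaleC_right_distrib scaleC_left_distrib scaleC_scaleC scaleC_one)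


section \<open>The algebraic tensor product\<close>

text \<open>The free complex vector space on pairs, modulo the span of the bilinearity relations.\<close>

definition free_scale :: "complex \<Rightarrow> ('k \<Rightarrow>\<^sub>0 complex) \<Rightarrow> ('k \<Rightarrow>\<^sub>0 complex)" where
  "free_scale a f = Poly_Mapping.map ((*) a) f"

lemma lookup_free_scale [simp]:
  "Poly_Mapping.lookup (free_scale a f) k = a * Poly_Mapping.lookup f k"
  by (simp add: free_scale_def map.rep_eq when_def)

global_interpretation free: vector_space "free_scale :: complex \<Rightarrow> ('k \<Rightarrow>\<^sub>0 complex) \<Rightarrow> _"
  by unfold_locales (auto intro!: poly_mapping_eqI simp: lookup_add algebra_simps)

definition free_gen :: "'a \<Rightarrow> 'b \<Rightarrow> ('a \<times> 'b) \<Rightarrow>\<^sub>0 complex" where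
  "free_gen v w = Poly_Mapping.single (v, w) 1"

inductive_set bilinear_relations ::
  "(('a::complex_vector \<times> 'b::complex_vector) \<Rightarrow>\<^sub>0 complex) set" where
  add_left: "free_gen (v + v') w - free_gen v w - free_gen v' w \<in> bilinear_relations"
| add_right: "free_gen v (w + w') - free_gen v w - free_gen v w' \<in> bilinear_relations"
| scale_left: "free_gen (a *\<^sub>C v) w - free_scale a (free_gen v w) \<in> bilinear_relations"
| scale_right: "free_gen v (a *\<^sub>C w) - free_scale a (free_gen v w) \<in> bilinear_relations"

definition tensor_rel ::
  "(('a::complex_vector \<times> 'b::complex_vector) \<Rightarrow>\<^sub>0 complex) \<Rightarrow> ('a \<times> 'b \<Rightarrow>\<^sub>0 complex) \<Rightarrow> bool" where
  "tensor_rel f g \<longleftrightarrow> f - g \<in> free.span bilinear_relations"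

lemma equivp_tensor_rel: "equivp tensor_rel"
proof (rule equivpI)
  show "reflp tensor_rel"
    by (simp add: reflp_def tensor_rel_def free.span_zero)
  show "symp tensor_rel"
    using free.span_neg by (fastforce simp: symp_def tensor_rel_def)
  show "transp tensor_rel"
  proof (rule transpI)
    fix f g h
    assume "tensor_rel f g" "tensor_rel g h"
    then show "tensor_rel f h"
      using free.span_add[of "f - g" bilinear_relations "g - h"] by (simp add: tensor_rel_def)
  qed
qed

lemma diff_diff_diff_swap: "(f - g) - (f' - g') = (f - f') - (g - (g' :: 'a::ab_group_add))"
  by (simp add: algebra_simps)

quotient_type (overloaded) ('a, 'b) tensor =
  "('a::complex_vector \<times> 'b::complex_vector) \<Rightarrow>\<^sub>0 complex" / tensor_rel
  by (rule equivp_tensor_rel)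

instantiation tensor :: (complex_vector, complex_vector) complex_vector
begin

lift_definition zero_tensor :: "('a, 'b) tensor" is 0 .

lift_definition plus_tensor :: "('a, 'b) tensor \<Rightarrow> ('a, 'b) tensor \<Rightarrow> ('a, 'b) tensor" is "(+)"
  unfolding tensor_rel_def by (subst add_diff_add) (rule free.span_add)

lift_definition uminus_tensor :: "('a, 'b) tensor \<Rightarrow> ('a, 'b) tensor" is uminus
  unfolding tensor_rel_def by (subst minus_diff_minus) (rule free.span_neg)

lift_definition minus_tensor :: "('a, 'b) tensor \<Rightarrow> ('a, 'b) tensor \<Rightarrow> ('a, 'b) tensor" is "(-)"
  unfolding tensor_rel_def by (subst diff_diff_diff_swap) (rule free.span_diff)

lift_definition scaleC_tensor :: "complex \<Rightarrow> ('a, 'b) tensor \<Rightarrow> ('a, 'b) tensor" is free_scale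
  unfolding tensor_rel_def
  by (subst free.scale_right_diff_distrib[symmetric]) (rule free.span_scale)

instance
  by standard
    (transfer, simp add: tensor_rel_def free.span_zero free.scale_right_distrib free.scale_left_distrib)+

end

lift_definition tensor_prod ::
  "'a::complex_vector \<Rightarrow> 'b::complex_vector \<Rightarrow> ('a, 'b) tensor" (infixr "\<otimes>" 70) is free_gen .

lemma tensor_add_left: "(v + v') \<otimes> w = v \<otimes> w + v' \<otimes> w"
proof (transfer, unfold tensor_rel_def)
  fix v v' :: 'a and w :: 'b
  have "free_gen (v + v') w - free_gen v w - free_gen v' w \<in> free.span bilinear_relations"
    by (intro free.span_base bilinear_relations.intros)
  then show "free_gen (v + v') w - (free_gen v w + free_gen v' w) \<in> free.span bilinear_relations"
    by (simp add: diff_diff_eq)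
qed

lemma tensor_add_right: "v \<otimes> (w + w') = v \<otimes> w + v \<otimes> w'"
proof (transfer, unfold tensor_rel_def)
  fix v :: 'a and w w' :: 'b
  have "free_gen v (w + w') - free_gen v w - free_gen v w' \<in> free.span bilinear_relations"
    by (intro free.span_base bilinear_relations.intros)
  then show "free_gen v (w + w') - (free_gen v w + free_gen v w') \<in> free.span bilinear_relations"
    by (simp add: diff_diff_eq)
qed

lemma tensor_scale_left: "(a *\<^sub>C v) \<otimes> w = a *\<^sub>C (v \<otimes> w)"
  by (transfer, unfold tensor_rel_def, intro free.span_base bilinear_relations.intros)

lemma tensor_scale_right: "v \<otimes> (a *\<^sub>C w) = a *\<^sub>C (v \<otimes> w)"
  by (transfer, unfold tensor_rel_def, intro free.span_base bilinear_relations.intros)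

lemma tensor_zero_left [simp]: "0 \<otimes> w = 0"
  using tensor_add_left[of 0 0 w] by simp

lemma tensor_zero_right [simp]: "v \<otimes> 0 = 0"
  using tensor_add_right[of v 0 0] by simp


section \<open>The fermionic Fock space\<close>

text \<open>The last assumption says that the space is generated by the vacuum: it is the only
  subspace that contains the vacuum and is invariant under all modes.\<close>

locale fock_space =
  fixes b c :: "int \<Rightarrow> 'f::complex_vector \<Rightarrow> 'f"
    and vac :: 'f
  assumes linear_b: "Vector_Spaces.linear scaleC scaleC (b i)"
    and linear_c: "Vector_Spaces.linear scaleC scaleC (c i)"
    and anticomm_bc: "b i (c j v) + c j (b i v) = (if i = - j then v else 0)"
    and anticomm_bb: "b i (b j v) + b j (b i v) = 0"
    and anticomm_cc: "c i (c j v) + c j (c i v) = 0"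
    and vac_nonzero: "vac \<noteq> 0"
    and b_vac: "m \<ge> 0 \<Longrightarrow> b (m + 1) vac = 0"
    and c_vac: "m \<ge> 0 \<Longrightarrow> c m vac = 0"
    and generated: "\<lbrakk>complex_vector.subspace S; vac \<in> S;
        \<And>i v. v \<in> S \<Longrightarrow> b i v \<in> S; \<And>i v. v \<in> S \<Longrightarrow> c i v \<in> S\<rbrakk> \<Longrightarrow> S = UNIV"


section \<open>The KP bilinear identity\<close>

text \<open>A formal distribution \<open>\<Sum>n. f n z^n\<close> is represented by its coefficient function \<open>f\<close>.
  The two fields are evaluated at a vector of the Fock space, and
  \<open>(b(z) \<otimes> c(z)) (v \<otimes> w) = b(z) v \<otimes> c(z) w\<close>. On Fock spaces the sum in
  \<open>tensor_distribution\<close> has finitely many nonzero terms (see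
  \<open>finite_tensor_distribution\<close> below), so \<open>Sum_any\<close> is a genuine sum.\<close>

definition b_field :: "(int \<Rightarrow> 'f \<Rightarrow> 'f) \<Rightarrow> 'f \<Rightarrow> int \<Rightarrow> 'f" where
  "b_field b v n = b (- n) v"

definition c_field :: "(int \<Rightarrow> 'f \<Rightarrow> 'f) \<Rightarrow> 'f \<Rightarrow> int \<Rightarrow> 'f" where
  "c_field c v n = c (- n - 1) v"

definition tensor_distribution ::
  "(int \<Rightarrow> 'a::complex_vector) \<Rightarrow> (int \<Rightarrow> 'b::complex_vector) \<Rightarrow> int \<Rightarrow> ('a, 'b) tensor" where
  "tensor_distribution f g n = Sum_any (\<lambda>k. f k \<otimes> g (n - k))"

definition Res :: "(int \<Rightarrow> 'a) \<Rightarrow> 'a" where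
  "Res f = f (- 1)"

definition KP_tau_function ::
  "(int \<Rightarrow> 'f \<Rightarrow> 'f) \<Rightarrow> (int \<Rightarrow> 'f \<Rightarrow> 'f) \<Rightarrow> 'f::complex_vector \<Rightarrow> bool" where
  "KP_tau_function b c \<tau> \<longleftrightarrow> Res (tensor_distribution (b_field b \<tau>) (c_field c \<tau>)) = 0"


section \<open>The operators \<open>B(x)\<close>\<close>

text \<open>The exponential series of a locally nilpotent operator; on such an operator each of the
  sums has finitely many nonzero terms.\<close>

definition exp_op :: "('f::complex_vector \<Rightarrow> 'f) \<Rightarrow> 'f \<Rightarrow> 'f" where
  "exp_op T v = Sum_any (\<lambda>n. (1 / fact n) *\<^sub>C (T ^^ n) v)"

definition B_factor ::
  "(int \<Rightarrow> 'f \<Rightarrow> 'f) \<Rightarrow> (int \<Rightarrow> 'f \<Rightarrow> 'f) \<Rightarrow> complex \<Rightarrow> int \<Rightarrow> 'f::complex_vector \<Rightarrow> 'f" where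
  "B_factor b c x i = exp_op (\<lambda>v. x *\<^sub>C b (- (i - 1)) (c (i - 2) v))"

text \<open>The product of the \<open>k\<close> leftmost factors, those with \<open>i = M, M - 1, \<dots>, M - k + 1\<close>.\<close>

primrec B_partial ::
  "(int \<Rightarrow> 'f \<Rightarrow> 'f) \<Rightarrow> (int \<Rightarrow> 'f \<Rightarrow> 'f) \<Rightarrow> nat \<Rightarrow> complex \<Rightarrow> nat \<Rightarrow> 'f::complex_vector \<Rightarrow> 'f" where
  "B_partial b c M x 0 = id"
| "B_partial b c M x (Suc k) = B_partial b c M x k \<circ> B_factor b c x (int M - int k)"

text \<open>The infinite product applied to \<open>v\<close> is the value at which the finite partial products
  applied to \<open>v\<close> become stationary (they do, see \<open>B_op_eventually\<close> below).\<close>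

definition B_op ::
  "(int \<Rightarrow> 'f \<Rightarrow> 'f) \<Rightarrow> (int \<Rightarrow> 'f \<Rightarrow> 'f) \<Rightarrow> nat \<Rightarrow> complex \<Rightarrow> 'f::complex_vector \<Rightarrow> 'f" where
  "B_op b c M x v = (THE w. eventually (\<lambda>k. B_partial b c M x k v = w) sequentially)"


section \<open>Well-definedness\<close>

context fock_space
begin

lemma module_hom_b: "module_hom scaleC scaleC (b i)"
  and module_hom_c: "module_hom scaleC scaleC (c i)"
  using linear_b[of i] linear_c[of i] by (simp_all add: Vector_Spaces.linear_def)

lemmas b_add = module_hom.add[OF module_hom_b] and b_scale = module_hom.scale[OF module_hom_b]
lemmas c_add = module_hom.add[OF module_hom_c] and c_scale = module_hom.scale[OF module_hom_c]

lemma b_zero [simp]: "b i 0 = 0" and c_zero [simp]: "c i 0 = 0"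
  using b_add[of i 0 0] c_add[of i 0 0] by simp_all

lemma b_neg: "b i (- v) = - b i v"
  using b_add[of i v "- v"] by (simp add: eq_neg_iff_add_eq_0 add.commute)

lemma c_neg: "c i (- v) = - c i v"
  using c_add[of i v "- v"] by (simp add: eq_neg_iff_add_eq_0 add.commute)

lemma locally_annihilated: "\<exists>K. \<forall>i>K. b i v = 0 \<and> c i v = 0"
proof -
  let ?S = "{v. \<exists>K. \<forall>i>K. b i v = 0 \<and> c i v = 0}"
  have "?S = UNIV"
  proof (rule generated)
    show "complex_vector.subspace ?S"
    proof (rule complex_vector.subspaceI)
      show "0 \<in> ?S" by simp
    next
      fix v w assume "v \<in> ?S" "w \<in> ?S"
      then obtain K L where "\<forall>i>K. b i v = 0 \<and> c i v = 0" "\<forall>i>L. b i w = 0 \<and> c i w = 0"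
        by blast
      then have "\<forall>i>max K L. b i (v + w) = 0 \<and> c i (v + w) = 0"
        by (simp add: b_add c_add)
      then show "v + w \<in> ?S" by blast
    next
      fix a v assume "v \<in> ?S"
      then obtain K where "\<forall>i>K. b i v = 0 \<and> c i v = 0" by blast
      then have "\<forall>i>K. b i (a *\<^sub>C v) = 0 \<and> c i (a *\<^sub>C v) = 0"
        by (simp add: b_scale c_scale)
      then show "a *\<^sub>C v \<in> ?S" by blast
    qed
    have "b i vac = 0 \<and> c i vac = 0" if "i > 0" for i
      using that b_vac[of "i - 1"] c_vac[of i] by simp
    then show "vac \<in> ?S" by blast
  next
    fix i v assume "v \<in> ?S"
    then obtain K where K: "\<forall>i>K. b i v = 0 \<and> c i v = 0" by blast
    have "\<forall>j>max K (- i). b j (b i v) = 0 \<and> c j (b i v) = 0"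
    proof (intro allI impI)
      fix j assume "j > max K (- i)"
      then show "b j (b i v) = 0 \<and> c j (b i v) = 0"
        using K anticomm_bb[of i j v] anticomm_bc[of i j v] by simp
    qed
    then show "b i v \<in> ?S" by blast
    have "\<forall>j>max K (- i). b j (c i v) = 0 \<and> c j (c i v) = 0"
    proof (intro allI impI)
      fix j assume "j > max K (- i)"
      then show "b j (c i v) = 0 \<and> c j (c i v) = 0"
        using K anticomm_cc[of i j v] anticomm_bc[of j i v] by simp
    qed
    then show "c i v \<in> ?S" by blast
  qed
  then show ?thesis by blast
qed

lemma finite_tensor_distribution: "finite {k. b_field b v k \<otimes> c_field c w (n - k) \<noteq> 0}"
proof -
  obtain K L where K: "\<forall>i>K. b i v = 0 \<and> c i v = 0" and L: "\<forall>i>L. b i w = 0 \<and> c i w = 0"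
    using locally_annihilated by metis
  have "b_field b v k \<otimes> c_field c w (n - k) = 0" if "k < - K \<or> k > L + n + 1" for k
    using that K[rule_format, of "- k"] L[rule_format, of "k - n - 1"]
    by (auto simp: b_field_def c_field_def)
  then have "{k. b_field b v k \<otimes> c_field c w (n - k) \<noteq> 0} \<subseteq> {- K..L + n + 1}"
    by force
  then show ?thesis by (rule finite_subset) simp
qed

lemma finite_KP_terms: "finite {i. b i v \<otimes> c (- i) v \<noteq> 0}"
proof -
  obtain K where K: "\<forall>i>K. b i v = 0 \<and> c i v = 0"
    using locally_annihilated by metis
  then have "b i v \<otimes> c (- i) v = 0" if "i < - K \<or> i > K" for i
    using that K[rule_format, of i] K[rule_format, of "- i"] by auto
  then have "{i. b i v \<otimes> c (- i) v \<noteq> 0} \<subseteq> {- K..K}"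
    by force
  then show ?thesis by (rule finite_subset) simp
qed

lemma Res_bc:
  "Res (tensor_distribution (b_field b v) (c_field c v)) = Sum_any (\<lambda>i. b i v \<otimes> c (- i) v)"
proof -
  have "Sum_any (\<lambda>k. b (- k) v \<otimes> c k v) = Sum_any ((\<lambda>i. b i v \<otimes> c (- i) v) \<circ> uminus)"
    by (simp add: o_def)
  also have "\<dots> = Sum_any (\<lambda>i. b i v \<otimes> c (- i) v)"
    by (rule Sum_any.reindex_cong[symmetric, where l = uminus]) (auto simp: bij_uminus)
  finally show ?thesis
    by (simp add: Res_def tensor_distribution_def b_field_def c_field_def)
qed

lemma B_factor_eq: "B_factor b c x i v = v + x *\<^sub>C b (- (i - 1)) (c (i - 2) v)"
proof -
  define T where "T = (\<lambda>v. x *\<^sub>C b (- (i - 1)) (c (i - 2) v))"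
  have bb: "b j (b j u) = 0" for j u
    using anticomm_bb[of j j u] complex_vector.scale_eq_0_iff[of 2 "b j (b j u)"]
      scaleC_left_distrib[of 1 1 "b j (b j u)"] by (simp add: scaleC_one)
  have cb: "c (i - 2) (b (- (i - 1)) u) = - b (- (i - 1)) (c (i - 2) u)" for u
    using anticomm_bc[of "- (i - 1)" "i - 2" u] by (simp add: eq_neg_iff_add_eq_0 add.commute)
  have TT: "T (T u) = 0" for u
    using cb[of "c (i - 2) u"] by (simp add: T_def b_scale c_scale b_neg bb)
  have T0: "(T ^^ n) 0 = 0" for n
    by (induction n) (simp_all add: T_def)
  have high: "(T ^^ n) v = 0" if "n \<notin> {0, 1}" for n
  proof -
    from that obtain m where "n = m + 2" by (metis add_2_eq_Suc' insertCI not0_implies_Suc One_nat_def)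
    then show ?thesis
      by (simp add: funpow_add numeral_2_eq_2 TT T0)
  qed
  have "exp_op T v = (\<Sum>n\<in>{0, 1}. (1 / fact n) *\<^sub>C (T ^^ n) v)"
    unfolding exp_op_def by (rule Sum_any.expand_superset) (use high in force)+
  then show ?thesis
    by (simp add: B_factor_def T_def scaleC_one)
qed

lemma B_factor_eventually_id: "eventually (\<lambda>k. B_factor b c x (int M - int k) v = v) sequentially"
proof -
  obtain K where K: "\<forall>i>K. b i v = 0 \<and> c i v = 0"
    using locally_annihilated by metis
  have "B_factor b c x (int M - int k) v = v" if "k \<ge> nat (K + int M)" for k
  proof -
    let ?p = "- (int M - int k - 1)" and ?q = "int M - int k - 2"
    have "b ?p v = 0" using K that by simp
    then have "b ?p (c ?q v) = 0"
      using anticomm_bc[of ?p ?q v] by simp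
    then show ?thesis by (simp add: B_factor_eq)
  qed
  then show ?thesis unfolding eventually_sequentially by blast
qed

lemma B_op_eventually: "eventually (\<lambda>k. B_partial b c M x k v = B_op b c M x v) sequentially"
proof -
  obtain n where n: "B_factor b c x (int M - int k) v = v" if "k \<ge> n" for k
    using B_factor_eventually_id unfolding eventually_sequentially by meson
  have "B_partial b c M x k v = B_partial b c M x n v" if "k \<ge> n" for k
    using that by (induction k rule: dec_induct) (simp_all add: n)
  then have ev: "eventually (\<lambda>k. B_partial b c M x k v = B_partial b c M x n v) sequentially"
    unfolding eventually_sequentially by blast
  moreover have "w = B_partial b c M x n v"
    if "eventually (\<lambda>k. B_partial b c M x k v = w) sequentially" for w
    using eventually_happens[OF eventually_conj[OF ev that]] by auto
  ultimately have "B_op b c M x v = B_partial b c M x n v"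
    unfolding B_op_def by (rule the_equality)
  with ev show ?thesis by simp
qed

end

end

theory Submission
  imports Defs
begin

text \<open>
  The Casimir element \<open>\<Sum>i. b i \<otimes> c (- i)\<close> commutes with \<open>g \<otimes> g\<close> for every \<open>g\<close> in the
  group generated by exponentials of quadratic expressions in the fermions, and it kills
  \<open>vac \<otimes> vac\<close>; so every vector of the orbit of the vacuum under this group is a tau function.

  Only factors \<open>g = 1 + x b(p) c(q)\<close> with \<open>p + q \<noteq> 0\<close> occur here (in fact \<open>p + q = - 1\<close>), and the
  commutation is checked on them by hand. Moving \<open>g\<close> past \<open>b i\<close> costs a correction only for
  \<open>i = - q\<close>, moving it past \<open>c (- i)\<close> one only for \<open>i = p\<close>; these two indices are different, and
  the two corrections are the opposite tensors \<open>- x b(p) v \<otimes> c(q) v\<close> and \<open>x b(p) v \<otimes> c(q) v\<close>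
  (\<open>casimir_fermion_factor\<close>). Hence the Casimir sum of \<open>g v\<close> is the image under \<open>g \<otimes> g\<close> of that
  of \<open>v\<close>. The existence of \<open>g \<otimes> g\<close> as a linear map is an instance of the universal property of
  the tensor product (\<open>tensor_universal\<close>). The infinite product \<open>B(x)\<close> agrees on each vector
  with a finite product of such factors, so it preserves the vectors with vanishing Casimir sum.
\<close>

section \<open>The universal property of the tensor product\<close>

definition free_extend :: "('k \<Rightarrow> 'c::complex_vector) \<Rightarrow> ('k \<Rightarrow>\<^sub>0 complex) \<Rightarrow> 'c" where
  "free_extend \<beta> f = (\<Sum>k\<in>Poly_Mapping.keys f. Poly_Mapping.lookup f k *\<^sub>C \<beta> k)"

lemma free_extend_superset:
  assumes "finite A" "Poly_Mapping.keys f \<subseteq> A"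
  shows "free_extend \<beta> f = (\<Sum>k\<in>A. Poly_Mapping.lookup f k *\<^sub>C \<beta> k)"
  unfolding free_extend_def using assms by (intro sum.mono_neutral_left) (auto simp: in_keys_iff)

lemma linear_free_extend: "Vector_Spaces.linear free_scale scaleC (free_extend \<beta>)"
proof (unfold_locales)
  fix f g :: "'a \<Rightarrow>\<^sub>0 complex" and a :: complex
  let ?A = "Poly_Mapping.keys f \<union> Poly_Mapping.keys g"
  have keys: "Poly_Mapping.keys (f + g) \<subseteq> ?A" "Poly_Mapping.keys (free_scale a f) \<subseteq> ?A"
    by (auto simp: in_keys_iff lookup_add)
  show "free_extend \<beta> (f + g) = free_extend \<beta> f + free_extend \<beta> g"
    using keys by (simp add: free_extend_superset[of ?A] lookup_add scaleC_left_distrib sum.distrib)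
  show "free_extend \<beta> (free_scale a f) = a *\<^sub>C free_extend \<beta> f"
    using keys by (simp add: free_extend_superset[of ?A] complex_vector.scale_sum_right scaleC_scaleC)
qed

lemma free_extend_gen: "free_extend \<beta> (free_gen v w) = \<beta> (v, w)"
  by (simp add: free_extend_def free_gen_def scaleC_one)

text \<open>The linear extension of \<open>\<beta>\<close> to the free space on pairs kills each of the relations, because
  these express bilinearity; so it kills their span and descends to the quotient.\<close>

lemma tensor_universal:
  fixes \<beta> :: "'a::complex_vector \<Rightarrow> 'b::complex_vector \<Rightarrow> 'c::complex_vector"
  assumes left: "\<And>w. Vector_Spaces.linear scaleC scaleC (\<lambda>v. \<beta> v w)"
    and right: "\<And>v. Vector_Spaces.linear scaleC scaleC (\<beta> v)"
  obtains L where "Vector_Spaces.linear scaleC scaleC L" "\<And>v w. L (v \<otimes> w) = \<beta> v w"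
proof -
  define F where "F = free_extend (case_prod \<beta>)"
  interpret F: Vector_Spaces.linear free_scale scaleC F
    unfolding F_def by (rule linear_free_extend)
  interpret left: Vector_Spaces.linear scaleC scaleC "\<lambda>v. \<beta> v w" for w by (rule left)
  interpret right: Vector_Spaces.linear scaleC scaleC "\<beta> v" for v by (rule right)
  have gen: "F (free_gen v w) = \<beta> v w" for v w
    by (simp add: F_def free_extend_gen)
  have kernel: "F f = 0" if "f \<in> free.span bilinear_relations" for f
    using that
  proof (induction rule: free.span_induct)
    case base
    show ?case
      by (rule free.subspaceI) (simp_all add: F.zero F.add F.scale)
  next
    case (step f)
    then show ?case
      by (cases rule: bilinear_relations.cases)
        (simp_all add: F.diff F.scale gen left.add left.scale right.add right.scale)
  qed
  define L where "L t = F (rep_tensor t)" for t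
  have L: "L (abs_tensor f) = F f" for f
  proof -
    have "tensor_rel (rep_tensor (abs_tensor f)) f"
      by (simp add: Quotient3_tensor rep_abs_rsp_left equivp_reflp[OF equivp_tensor_rel])
    then have "F (rep_tensor (abs_tensor f) - f) = 0"
      unfolding tensor_rel_def by (rule kernel)
    then show ?thesis by (simp add: L_def F.diff)
  qed
  have "Vector_Spaces.linear scaleC scaleC L"
  proof (unfold_locales)
    fix s t :: "('a, 'b) tensor" and a
    obtain f g where fg: "s = abs_tensor f" "t = abs_tensor g"
      by (metis Quotient3_tensor Quotient3_abs_rep)
    show "L (s + t) = L s + L t"
      by (simp add: fg plus_tensor.abs_eq L F.add)
    show "L (a *\<^sub>C s) = a *\<^sub>C L s"
      by (simp add: fg scaleC_tensor.abs_eq L F.scale)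
  qed
  moreover have "L (v \<otimes> w) = \<beta> v w" for v w
    by (simp add: tensor_prod.abs_eq L gen)
  ultimately show ?thesis by (rule that)
qed

lemma tensor_map_exists:
  fixes f :: "'a::complex_vector \<Rightarrow> 'c::complex_vector"
    and g :: "'b::complex_vector \<Rightarrow> 'd::complex_vector"
  assumes "Vector_Spaces.linear scaleC scaleC f" "Vector_Spaces.linear scaleC scaleC g"
  obtains L where "Vector_Spaces.linear scaleC scaleC L" "\<And>v w. L (v \<otimes> w) = f v \<otimes> g w"
proof (rule tensor_universal)
  interpret f: Vector_Spaces.linear scaleC scaleC f by (rule assms)
  interpret g: Vector_Spaces.linear scaleC scaleC g by (rule assms)
  show "Vector_Spaces.linear scaleC scaleC (\<lambda>v. f v \<otimes> g w)" for w
    by unfold_locales (simp_all add: f.add f.scale tensor_add_left tensor_scale_left)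
  show "Vector_Spaces.linear scaleC scaleC (\<lambda>w. f v \<otimes> g w)" for v
    by unfold_locales (simp_all add: g.add g.scale tensor_add_right tensor_scale_right)
qed (use that in blast)

lemma tensor_minus_left: "(- v) \<otimes> w = - (v \<otimes> w)"
  using tensor_add_left[of v "- v" w] by (simp add: eq_neg_iff_add_eq_0 add.commute)


section \<open>The Casimir element and quadratic exponentials\<close>

context fock_space
begin

definition casimir :: "'f \<Rightarrow> ('f, 'f) tensor" where
  "casimir v = Sum_any (\<lambda>i. b i v \<otimes> c (- i) v)"

lemma KP_tau_function_iff: "KP_tau_function b c v \<longleftrightarrow> casimir v = 0"
  by (simp add: KP_tau_function_def Res_bc casimir_def)

text \<open>Each summand contains an annihilator of the vacuum: \<open>b i\<close> if \<open>i > 0\<close>, otherwise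
  \<open>c (- i)\<close>.\<close>

lemma casimir_vac: "casimir vac = 0"
proof -
  have "b i vac \<otimes> c (- i) vac = 0" for i
    using b_vac[of "i - 1"] c_vac[of "- i"] by (cases "i > 0") simp_all
  then show ?thesis by (simp add: casimir_def)
qed

text \<open>For \<open>p + q \<noteq> 0\<close> the operator \<open>b p \<circ> c q\<close> has square zero, so this is the exponential of
  its multiple by \<open>x\<close>.\<close>

definition fermion_factor :: "complex \<Rightarrow> int \<Rightarrow> int \<Rightarrow> 'f \<Rightarrow> 'f" where
  "fermion_factor x p q v = v + x *\<^sub>C b p (c q v)"

lemma linear_fermion_factor: "Vector_Spaces.linear scaleC scaleC (fermion_factor x p q)"
  by unfold_locales
    (simp_all add: fermion_factor_def b_add b_scale c_add c_scale scaleC_right_distrib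
      scaleC_scaleC mult.commute)

lemma b_b_zero: "b i (b i v) = 0"
  using anticomm_bb[of i i v] complex_vector.scale_eq_0_iff[of 2 "b i (b i v)"]
    scaleC_left_distrib[of 1 1 "b i (b i v)"] by (simp add: scaleC_one)

lemma c_c_zero: "c i (c i v) = 0"
  using anticomm_cc[of i i v] complex_vector.scale_eq_0_iff[of 2 "c i (c i v)"]
    scaleC_left_distrib[of 1 1 "c i (c i v)"] by (simp add: scaleC_one)

lemma c_b_swap: "c j (b i v) = (if i = - j then v else 0) - b i (c j v)"
  using anticomm_bc[of i j v] by (metis add_diff_cancel_left')

lemma b_fermion_factor:
  "b i (fermion_factor x p q v) =
    fermion_factor x p q (b i v) + (if i = - q then (- x) *\<^sub>C b p v else 0)"
proof -
  have "b i (b p (c q v)) = - b p (b i (c q v))"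
    using anticomm_bb[of i p "c q v"] by (simp add: eq_neg_iff_add_eq_0)
  moreover have "b p (b i (c q v)) = (if i = - q then b p v else 0) - b p (c q (b i v))"
    using arg_cong[OF anticomm_bc[of i q v], of "b p"] by (auto simp: b_add eq_diff_eq)
  ultimately show ?thesis
    by (simp add: fermion_factor_def b_add b_scale complex_vector.scale_right_diff_distrib)
qed

lemma c_fermion_factor:
  "c j (fermion_factor x p q v) =
    fermion_factor x p q (c j v) + (if j = - p then x *\<^sub>C c q v else 0)"
proof -
  have "b p (c j (c q v)) = - b p (c q (c j v))"
    using anticomm_cc[of j q v] by (metis b_neg eq_neg_iff_add_eq_0)
  then have "c j (b p (c q v)) = (if j = - p then c q v else 0) + b p (c q (c j v))"
    by (auto simp: c_b_swap)
  then show ?thesis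
    by (simp add: fermion_factor_def c_add c_scale scaleC_right_distrib)
qed

text \<open>The corrections by which \<open>g = fermion_factor x p q\<close> fails to commute with the fermions are
  tensored with \<open>g (c q v)\<close> and \<open>g (b p v)\<close>. Both arguments are fixed by \<open>g\<close>, because
  \<open>c q \<circ> c q\<close> and \<open>b p \<circ> b p\<close> vanish, which is why the two corrections cancel.\<close>

lemma casimir_fermion_factor:
  assumes pq: "p + q \<noteq> 0" and v: "casimir v = 0"
  shows "casimir (fermion_factor x p q v) = 0"
proof -
  let ?g = "fermion_factor x p q"
  let ?e = "x *\<^sub>C (b p v \<otimes> c q v)"
  have gc: "?g (c q v) = c q v"
    by (simp add: fermion_factor_def c_c_zero)
  have gb: "?g (b p v) = b p v"
    using pq by (auto simp: fermion_factor_def c_b_swap b_neg b_b_zero)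
  have summand: "b i (?g v) \<otimes> c (- i) (?g v) =
      ?g (b i v) \<otimes> ?g (c (- i) v) + ((if i = - q then - ?e else 0) + (if i = p then ?e else 0))" for i
    using pq
    by (auto simp: b_fermion_factor c_fermion_factor gc gb tensor_add_left tensor_add_right
        tensor_scale_left tensor_scale_right tensor_minus_left)
  define A where "A = {i. b i v \<otimes> c (- i) v \<noteq> 0} \<union> {i. b i (?g v) \<otimes> c (- i) (?g v) \<noteq> 0} \<union> {p, - q}"
  have A: "finite A"
    by (simp add: A_def finite_KP_terms)
  have sum_v: "(\<Sum>i\<in>A. b i v \<otimes> c (- i) v) = 0"
    using v A unfolding casimir_def by (subst (asm) Sum_any.expand_superset[of A]) (auto simp: A_def)
  obtain L where L: "Vector_Spaces.linear scaleC scaleC L" "\<And>v w. L (v \<otimes> w) = ?g v \<otimes> ?g w"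
    using tensor_map_exists[OF linear_fermion_factor linear_fermion_factor] by metis
  interpret L: Vector_Spaces.linear scaleC scaleC L by (rule L(1))
  have "casimir (?g v) = (\<Sum>i\<in>A. b i (?g v) \<otimes> c (- i) (?g v))"
    unfolding casimir_def by (rule Sum_any.expand_superset[OF A]) (auto simp: A_def)
  also have "\<dots> = (\<Sum>i\<in>A. ?g (b i v) \<otimes> ?g (c (- i) v))
      + ((\<Sum>i\<in>A. if i = - q then - ?e else 0) + (\<Sum>i\<in>A. if i = p then ?e else 0))"
    by (simp only: summand sum.distrib)
  also have "\<dots> = (\<Sum>i\<in>A. ?g (b i v) \<otimes> ?g (c (- i) v))"
    using A by (simp add: A_def)
  also have "\<dots> = L (\<Sum>i\<in>A. b i v \<otimes> c (- i) v)"
    by (simp add: L.sum L(2))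
  also have "\<dots> = 0"
    by (simp add: sum_v L.zero)
  finally show ?thesis .
qed

lemma casimir_B_partial: "casimir v = 0 \<Longrightarrow> casimir (B_partial b c M x k v) = 0"
proof (induction k arbitrary: v)
  case (Suc k)
  have "B_factor b c x i v = fermion_factor x (- (i - 1)) (i - 2) v" for i
    by (simp add: B_factor_eq fermion_factor_def)
  then have "casimir (B_factor b c x i v) = 0" for i
    using Suc.prems by (simp add: casimir_fermion_factor)
  then show ?case by (simp add: Suc.IH)
qed simp

lemma casimir_B_op:
  assumes "casimir v = 0"
  shows "casimir (B_op b c M x v) = 0"
proof -
  obtain k where "B_partial b c M x k v = B_op b c M x v"
    using eventually_happens'[OF sequentially_bot B_op_eventually] by blast
  then show ?thesis
    using casimir_B_partial[OF assms] by metis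
qed

lemma casimir_B_op_product: "casimir (foldr (\<lambda>n. B_op b c M (x n)) ns vac) = 0"
  by (induction ns) (simp_all add: casimir_vac casimir_B_op)

end


section \<open>The tau function\<close>

theorem mainTheorem11:
  fixes b c :: "int \<Rightarrow> 'f::complex_vector \<Rightarrow> 'f" and vac \<tau> :: 'f
    and M N :: nat and x :: "nat \<Rightarrow> complex"
  assumes "fock_space b c vac" and "M > 0" and "N > 0"
    and "\<tau> = foldr (\<lambda>n. B_op b c M (x n)) [1..<N + 1] vac"
  shows "KP_tau_function b c \<tau> \<and> Sum_any (\<lambda>i. b i \<tau> \<otimes> c (- i) \<tau>) = 0"
proof -
  interpret fock_space b c vac by (rule assms(1))
  have "casimir \<tau> = 0"
    unfolding assms(4) by (rule casimir_B_op_product)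
  then show ?thesis
    by (simp add: KP_tau_function_iff casimir_def)
qed

end
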